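(* Let $M\ge 3$ be an integer, and let $p\in\mathbb{Z}$, $q\in\mathbb{Z}_{>0}$ be coprime. For $n\in\mathbb{Z}$ let \[ G(-p,n,q)=\sum_{k=0}^{q-1}\exp\Big(\frac{2\pi i(-pk^2+nk)}{q}\Big), \] and, for those $n$ with $0\le n\le q-1$ and $4\nmid q-2n$, let $\theta_n$ be the argument of $G(-p,n,q)$. Let $\rho\in[0,\pi]$ and define the rotation \[ \mathcal R=\prod_{\substack{n=0\\ 4\nmid q-2n}}^{q-1} R\big(e^{i\theta_{q-1-n}},\rho\big), \] where the product is ordered with the factor of smallest $n$ on the left (e.g. for $q$ odd, $\mathcal R=R(e^{i\theta_{q-1}},\rho)R(e^{i\theta_{q-2}},\rho)\cdots R(e^{i\theta_0},\rho)$). Then $\mathcal R$ is a rotation of angle $2\pi/M$ (about some axis) if and only if \[ \cos^q\Big(\frac{\rho}{2}\Big)=\cos\Big(\frac{\pi}{M}\Big)\ \text{ if $q$ is odd},\qquad \cos^q\Big(\frac{\rho}{2}\Big)=\cos^2\Big(\frac{\pi}{M}\Big)\ \text{ if $q$ is even}. \]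
   Context: For a unit vector $\vec v\in\mathbb{R}^3$ and an angle $\alpha$, $R(\vec v,\alpha)\in SO(3)$ denotes the rotation of axis $\vec v$ and angle $\alpha$. Complex numbers are identified with vectors in the plane $\{z=0\}$ of $\mathbb{R}^3$, so $R(e^{i\theta},\alpha)$ means $R((\cos\theta,\sin\theta,0),\alpha)$. The notation $a\mid b$ means $b/a\in\mathbb{Z}$ and $a\nmid b$ its negation. The condition $4\nmid q-2n$ excludes exactly the $n$ for which $G(-p,n,q)=0$ (it is automatically satisfied for $q$ odd). In the paper $\rho$ is the angle between two adjacent sides of a polygon, hence lies in $[0,\pi]$.
   Formalization: For even q the angles θ_{q-1-n} in the product fall outside the stated range of definition of θ (where 4∤q-2n the sum G(-p,n,q) is 0); here θ_n is the argument of G(-p,n,q) for every n, and the product, kept as printed, uses only nonvanishing sums. *)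

theory Defs
  imports "HOL-Analysis.Analysis"
begin

definition gauss_sum :: "int \<Rightarrow> int \<Rightarrow> nat \<Rightarrow> complex" where
  "gauss_sum a b c =
     (\<Sum>k<c. exp (2 * of_real pi * \<i> * of_int (a * int k ^ 2 + b * int k) / of_nat c))"

text \<open>The value for a vanishing sum (where \<open>Arg 0 = 0\<close>)
  is irrelevant: such sums do not occur in the product below.\<close>

definition theta :: "int \<Rightarrow> nat \<Rightarrow> int \<Rightarrow> real" where
  "theta p q n = Arg (gauss_sum (- p) n q)"

definition plane_vec :: "complex \<Rightarrow> real ^ 3" where
  "plane_vec z = vector [Re z, Im z, 0]"

text \<open>Rotation about the axis \<open>v\<close> (meant for \<open>norm v = 1\<close>) by the angle \<open>\<alpha>\<close>, oriented by
  the right-hand rule (Rodrigues' formula).\<close>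

definition rot :: "real ^ 3 \<Rightarrow> real \<Rightarrow> real ^ 3 ^ 3" where
  "rot v \<alpha> = matrix (\<lambda>x. cos \<alpha> *\<^sub>R x + sin \<alpha> *\<^sub>R cross3 v x + ((1 - cos \<alpha>) * (v \<bullet> x)) *\<^sub>R v)"

definition is_rotation_of_angle :: "real ^ 3 ^ 3 \<Rightarrow> real \<Rightarrow> bool" where
  "is_rotation_of_angle A \<alpha> \<longleftrightarrow> (\<exists>v. norm v = 1 \<and> A = rot v \<alpha>)"

text \<open>For even \<open>q\<close> coprime to \<open>p\<close> the sum \<open>gauss_sum (- p) m q\<close> is nonzero iff \<open>4 dvd int q - 2 * m\<close>,
  and for \<open>m = int q - 1 - n\<close> this is equivalent to \<open>\<not> 4 dvd int q - 2 * n\<close>.\<close>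

definition rotation_product :: "int \<Rightarrow> nat \<Rightarrow> real \<Rightarrow> real ^ 3 ^ 3" where
  "rotation_product p q \<rho> =
     foldr (\<lambda>n A. rot (plane_vec (cis (theta p q (int q - 1 - n)))) \<rho> ** A)
       [n \<leftarrow> [0..int q - 1]. \<not> 4 dvd int q - 2 * n] (mat 1)"

lemma rot_mult_vec:
  "rot v \<alpha> *v x = cos \<alpha> *\<^sub>R x + sin \<alpha> *\<^sub>R cross3 v x + ((1 - cos \<alpha>) * (v \<bullet> x)) *\<^sub>R v"
proof -
  have "linear (\<lambda>x. cos \<alpha> *\<^sub>R x + sin \<alpha> *\<^sub>R cross3 v x + ((1 - cos \<alpha>) * (v \<bullet> x)) *\<^sub>R v)"
    by (rule linearI)
      (simp_all add: cross_add_right cross_mult_right inner_add_right algebra_simps)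
  then show ?thesis
    unfolding rot_def by (rule fun_cong[OF matrix_vector_mul(2)])
qed

lemma rot_axis: "norm v = 1 \<Longrightarrow> rot v \<alpha> *v v = v"
  by (simp add: rot_mult_vec dot_square_norm cross_refl flip: scaleR_add_left)

lemma rot_orthogonal: "v \<bullet> w = 0 \<Longrightarrow> rot v \<alpha> *v w = cos \<alpha> *\<^sub>R w + sin \<alpha> *\<^sub>R cross3 v w"
  by (simp add: rot_mult_vec)

lemma norm_plane_vec [simp]: "norm (plane_vec z) = cmod z"
  by (simp add: plane_vec_def norm_vec_def L2_set_def sum_3 cmod_def)

end

theory Submission
  imports Defs "HOL-Computational_Algebra.Polynomial"
begin

text \<open>Lift the rotations to unit quaternions, represented as pairs \<open>(\<alpha>, \<beta>)\<close> of complex numbers.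
  With \<open>c = cos (\<rho>/2)\<close> and \<open>s = sin (\<rho>/2)\<close> the factor with axis \<open>u\<close> becomes \<open>(c, s u)\<close>, and the
  product of \<open>N\<close> factors is a rotation of angle \<open>2\<phi>\<close> according to the real part of its quaternion,
  i.e. half the trace of the product in \<open>SU(2)\<close>. This real part is always \<open>c\<^sup>N\<close>:
  consecutive nonzero Gauss sums differ by a phase \<open>z \<omega>\<^sup>k\<close> with \<open>\<omega>\<close> a primitive \<open>N\<close>-th
  root of unity, so conjugating by diagonal matrices turns the trace into that of the product of
  \<open>A diag(1, z \<omega>\<^sup>k)\<close> over \<open>k < N\<close> for a fixed matrix \<open>A\<close>. As a polynomial in \<open>z\<close> this trace has
  degree at most \<open>N\<close> and, by cyclicity, is invariant under \<open>z \<mapsto> \<omega> z\<close>; only the extreme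
  coefficients survive, and they are read off the diagonal of \<open>A\<close>. Here \<open>N = q\<close> for odd \<open>q\<close>
  and \<open>N = q/2\<close> for even \<open>q\<close>.\<close>

section \<open>Rotations of three-space as unit quaternions\<close>

text \<open>The quaternion \<open>a + b i + c j + d k\<close> is encoded by \<open>\<alpha> = a + d \<i>\<close> and \<open>\<beta> = b + c \<i>\<close>, so that
  axes in the plane \<open>{z = 0}\<close> correspond to \<open>\<beta>\<close> itself.\<close>

definition quat_rot :: "complex \<Rightarrow> complex \<Rightarrow> real ^ 3 ^ 3" where
  "quat_rot \<alpha> \<beta> = (let a = Re \<alpha>; b = Re \<beta>; c = Im \<beta>; d = Im \<alpha> in vector
     [vector [a\<^sup>2 + b\<^sup>2 - c\<^sup>2 - d\<^sup>2, 2 * (b * c - a * d), 2 * (b * d + a * c)],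
      vector [2 * (b * c + a * d), a\<^sup>2 - b\<^sup>2 + c\<^sup>2 - d\<^sup>2, 2 * (c * d - a * b)],
      vector [2 * (b * d - a * c), 2 * (c * d + a * b), a\<^sup>2 - b\<^sup>2 - c\<^sup>2 + d\<^sup>2]])"

text \<open>With the quaternion written as \<open>\<alpha> + \<beta> i\<close> over the complex
  numbers \<open>a + d k\<close>, the relation \<open>i \<gamma> = cnj \<gamma> i\<close> yields
  this pair as the quaternion product.\<close>

lemma quat_rot_mult:
  "quat_rot \<alpha> \<beta> ** quat_rot \<gamma> \<delta> = quat_rot (\<alpha> * \<gamma> - \<beta> * cnj \<delta>) (\<alpha> * \<delta> + \<beta> * cnj \<gamma>)"
  by (simp add: vec_eq_iff forall_3 matrix_matrix_mult_def sum_3 quat_rot_def Let_def)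
     (simp add: algebra_simps power2_eq_square)

lemma quat_rot_one: "quat_rot 1 0 = mat 1"
  by (simp add: vec_eq_iff forall_3 quat_rot_def mat_def)

text \<open>Rodrigues' formula in half angles; the diagonal entries agree because the axis has norm
  1.\<close>

lemma rot_eq_quat_rot:
  assumes "norm v = 1"
  shows "rot v (2 * \<phi>) =
    quat_rot (Complex (cos \<phi>) (sin \<phi> * v $ 3)) (Complex (sin \<phi> * v $ 1) (sin \<phi> * v $ 2))"
proof -
  have "v \<bullet> v = 1" using assms by (simp add: dot_square_norm)
  then have v: "(v $ 1)\<^sup>2 + (v $ 2)\<^sup>2 + (v $ 3)\<^sup>2 = 1"
    by (simp add: inner_vec_def sum_3 power2_eq_square)
  have c: "(cos \<phi>)\<^sup>2 = 1 - (sin \<phi>)\<^sup>2" by (simp add: cos_squared_eq)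
  have c2: "cos (2 * \<phi>) = 1 - 2 * (sin \<phi>)\<^sup>2" by (simp add: cos_double c)
  have s: "sin \<phi> * (sin \<phi> * (v $ 1 * v $ 1)) + (sin \<phi> * (sin \<phi> * (v $ 2 * v $ 2)) +
      sin \<phi> * (sin \<phi> * (v $ 3 * v $ 3))) = sin \<phi> * sin \<phi>"
    using v by (simp add: power2_eq_square add.assoc flip: distrib_left)
  show ?thesis
    by (simp add: vec_eq_iff forall_3 rot_def matrix_def quat_rot_def Let_def inner_vec_def sum_3
          cross3_def axis_def c2 sin_double power_mult_distrib c)
       (simp add: algebra_simps power2_eq_square, use s in linarith)
qed

lemma rot_plane_vec:
  assumes "cmod u = 1"
  shows "rot (plane_vec u) \<rho> = quat_rot (of_real (cos (\<rho> / 2))) (of_real (sin (\<rho> / 2)) * u)"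
proof -
  have "Complex (cos (\<rho> / 2)) 0 = of_real (cos (\<rho> / 2))"
    "Complex (sin (\<rho> / 2) * Re u) (sin (\<rho> / 2) * Im u) = of_real (sin (\<rho> / 2)) * u"
    by (simp_all add: complex_eq_iff)
  moreover have "plane_vec u $ 1 = Re u" "plane_vec u $ 2 = Im u" "plane_vec u $ 3 = 0"
    by (simp_all add: plane_vec_def)
  ultimately show ?thesis
    using rot_eq_quat_rot[of "plane_vec u" "\<rho> / 2"] assms by simp
qed

lemma trace_quat_rot:
  assumes "(cmod \<alpha>)\<^sup>2 + (cmod \<beta>)\<^sup>2 = 1"
  shows "trace (quat_rot \<alpha> \<beta>) = 4 * (Re \<alpha>)\<^sup>2 - 1"
  using assms by (simp add: trace_def sum_3 quat_rot_def Let_def cmod_power2)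

text \<open>The trace \<open>4 * (Re \<alpha>)\<^sup>2 - 1\<close> fixes \<open>Re \<alpha>\<close>
  up to sign, and the sign conditions settle the rest.\<close>

lemma is_rotation_quat_rot_iff:
  assumes unit: "(cmod \<alpha>)\<^sup>2 + (cmod \<beta>)\<^sup>2 = 1" and "Re \<alpha> \<ge> 0"
    and "cos \<phi> \<ge> 0" and "sin \<phi> > 0"
  shows "is_rotation_of_angle (quat_rot \<alpha> \<beta>) (2 * \<phi>) \<longleftrightarrow> Re \<alpha> = cos \<phi>"
proof
  assume "is_rotation_of_angle (quat_rot \<alpha> \<beta>) (2 * \<phi>)"
  then obtain v where v: "norm v = 1" "quat_rot \<alpha> \<beta> = rot v (2 * \<phi>)"
    by (auto simp: is_rotation_of_angle_def)
  have vv: "(v $ 1)\<^sup>2 + (v $ 2)\<^sup>2 + (v $ 3)\<^sup>2 = 1"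
    using v(1) dot_square_norm[of v] by (simp add: inner_vec_def sum_3 power2_eq_square)
  have "(cos \<phi>)\<^sup>2 + (sin \<phi>)\<^sup>2 * ((v $ 1)\<^sup>2 + (v $ 2)\<^sup>2 + (v $ 3)\<^sup>2) = 1"
    by (simp add: vv)
  then have "trace (rot v (2 * \<phi>)) = 4 * (cos \<phi>)\<^sup>2 - 1"
    using trace_quat_rot[of "Complex (cos \<phi>) (sin \<phi> * v $ 3)" "Complex (sin \<phi> * v $ 1) (sin \<phi> * v $ 2)"] v(1)
    by (simp add: rot_eq_quat_rot[OF v(1)] cmod_power2 power_mult_distrib distrib_left add.assoc)
  then have "(Re \<alpha>)\<^sup>2 = (cos \<phi>)\<^sup>2"
    using trace_quat_rot[OF unit] v(2) by simp
  then show "Re \<alpha> = cos \<phi>"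
    using assms by (simp add: power2_eq_iff_nonneg)
next
  assume eq: "Re \<alpha> = cos \<phi>"
  \<comment> \<open>The axis is the imaginary part of the quaternion, which has norm
    \<open>sin \<phi>\<close>.\<close>
  define v :: "real ^ 3" where "v = (1 / sin \<phi>) *\<^sub>R vector [Re \<beta>, Im \<beta>, Im \<alpha>]"
  have "(Re \<beta>)\<^sup>2 + (Im \<beta>)\<^sup>2 + (Im \<alpha>)\<^sup>2 = (sin \<phi>)\<^sup>2"
    using unit by (simp add: cmod_power2 eq sin_squared_eq)
  then have "norm (vector [Re \<beta>, Im \<beta>, Im \<alpha>] :: real ^ 3) = sin \<phi>"
    using assms by (simp add: norm_vec_def L2_set_def sum_3)
  then have v1: "norm v = 1" using assms by (simp add: v_def)
  have "quat_rot \<alpha> \<beta> = rot v (2 * \<phi>)"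
    unfolding rot_eq_quat_rot[OF v1] using assms by (simp add: v_def flip: eq)
  with v1 show "is_rotation_of_angle (quat_rot \<alpha> \<beta>) (2 * \<phi>)"
    by (auto simp: is_rotation_of_angle_def)
qed

section \<open>Matrix products and their traces\<close>

primrec mat_prod :: "(nat \<Rightarrow> 'a::semiring_1 ^ 'n ^ 'n) \<Rightarrow> nat \<Rightarrow> 'a ^ 'n ^ 'n" where
  "mat_prod X 0 = mat 1"
| "mat_prod X (Suc n) = mat_prod X n ** X n"

lemma mat_prod_Suc_shift: "mat_prod X (Suc n) = X 0 ** mat_prod (\<lambda>k. X (Suc k)) n"
  by (induction n) (simp_all add: matrix_mul_assoc)

lemma foldr_eq_mat_prod:
  fixes X :: "nat \<Rightarrow> 'a::semiring_1 ^ 'n ^ 'n"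
  shows "foldr (\<lambda>n A. X n ** A) [0..<n] (mat 1) = mat_prod X n"
proof -
  \<comment> \<open>Generalized over the final matrix, because splitting off the last index changes
    the starting value of the fold.\<close>
  have "foldr (\<lambda>n A. X n ** A) [0..<n] B = mat_prod X n ** B" for B :: "'a ^ 'n ^ 'n"
    by (induction n arbitrary: B) (simp_all add: matrix_mul_assoc)
  then show ?thesis by simp
qed

definition mat2 :: "'a \<Rightarrow> 'a \<Rightarrow> 'a \<Rightarrow> 'a \<Rightarrow> 'a::zero ^ 2 ^ 2" where
  "mat2 a b c d = vector [vector [a, b], vector [c, d]]"

lemma mat2_sel [simp]:
  "mat2 a b c d $ 1 $ 1 = a" "mat2 a b c d $ 1 $ 2 = b"
  "mat2 a b c d $ 2 $ 1 = c" "mat2 a b c d $ 2 $ 2 = d"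
  by (simp_all add: mat2_def)

lemma mat2_mult:
  "mat2 a b c d ** mat2 a' b' c' d' =
    mat2 (a * a' + b * c') (a * b' + b * d') (c * a' + d * c') (c * b' + d * d')"
  for a :: "'a::semiring_1"
  by (simp add: vec_eq_iff forall_2 matrix_matrix_mult_def sum_2)

lemma mat2_one: "mat2 1 0 0 1 = mat 1"
  by (simp add: vec_eq_iff forall_2 mat_def)

lemma trace_mat2: "trace (mat2 a b c d) = a + d"
  by (simp add: trace_def sum_2)

text \<open>In each factor \<open>z\<close> occurs only in the second column, linearly. So after
  each step the second column is divisible by \<open>z\<close>, while the degree of the first column
  stays one behind. The facts on \<open>p12\<close> and \<open>p21\<close> carry the induction: they
  make the extreme diagonal coefficients depend on \<open>a\<close> and \<open>d\<close>
  alone.\<close>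

lemma mat_prod_poly:
  fixes a b c d \<omega> :: "'a::comm_ring_1"
  shows "\<exists>p11 p12 p21 p22.
    (\<forall>z. mat_prod (\<lambda>k. mat2 a (b * (z * \<omega> ^ k)) c (d * (z * \<omega> ^ k))) n =
      mat2 (poly p11 z) (poly p12 z) (poly p21 z) (poly p22 z)) \<and>
    degree p11 \<le> n \<and> degree p12 \<le> n \<and> degree p21 \<le> n \<and> degree p22 \<le> n \<and>
    (n > 0 \<longrightarrow> coeff p11 n = 0) \<and> coeff p21 n = 0 \<and>
    coeff p22 n = d ^ n * (\<Prod>k<n. \<omega> ^ k) \<and> coeff p11 0 = a ^ n \<and> coeff p12 0 = 0 \<and> (n > 0 \<longrightarrow> coeff p22 0 = 0)"
proof (induction n)
  case 0
  show ?case
    by (rule exI[of _ 1], rule exI[of _ 0], rule exI[of _ 0], rule exI[of _ 1]) (simp add: mat2_one)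
next
  case (Suc n)
  then obtain p11 p12 p21 p22 where IH:
    "\<And>z. mat_prod (\<lambda>k. mat2 a (b * (z * \<omega> ^ k)) c (d * (z * \<omega> ^ k))) n =
      mat2 (poly p11 z) (poly p12 z) (poly p21 z) (poly p22 z)"
    "degree p11 \<le> n" "degree p12 \<le> n" "degree p21 \<le> n" "degree p22 \<le> n"
    "coeff p21 n = 0"
    "coeff p22 n = d ^ n * (\<Prod>k<n. \<omega> ^ k)" "coeff p11 0 = a ^ n"
    "coeff p12 0 = 0"
    by blast
  have deg: "coeff p11 (Suc n) = 0" "coeff p12 (Suc n) = 0" "coeff p21 (Suc n) = 0" "coeff p22 (Suc n) = 0"
    using IH(2-5) by (simp_all add: coeff_eq_0)
  have dl: "degree (smult x p + smult y r) \<le> Suc n"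
    if "degree p \<le> n" "degree r \<le> n" for x y p and r :: "'a poly"
    using that by (intro degree_add_le) (auto intro: order.trans[OF degree_smult_le])
  have dl': "degree (pCons 0 (smult x p + smult y r)) \<le> Suc n"
    if "degree p \<le> n" "degree r \<le> n" for x y p and r :: "'a poly"
    using that by (intro order.trans[OF degree_pCons_le])
      (auto intro!: degree_add_le intro: order.trans[OF degree_smult_le])
  show ?case
    using IH dl dl'
    by (intro exI[of _ "smult a p11 + smult c p12"] exI[of _ "pCons 0 (smult (b * \<omega> ^ n) p11 + smult (d * \<omega> ^ n) p12)"]
       exI[of _ "smult a p21 + smult c p22"] exI[of _ "pCons 0 (smult (b * \<omega> ^ n) p21 + smult (d * \<omega> ^ n) p22)"])
     (simp add: mat2_mult deg algebra_simps)
qed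

text \<open>The shifted product ends in \<open>X n = X 0\<close>, which cyclicity of the trace moves
  to the front.\<close>

lemma trace_mat_prod_rotate:
  fixes X :: "nat \<Rightarrow> 'a::comm_semiring_1 ^ 'n ^ 'n"
  assumes "X n = X 0"
  shows "trace (mat_prod (\<lambda>k. X (Suc k)) n) = trace (mat_prod X n)"
proof (cases n)
  case (Suc m)
  have "trace (mat_prod (\<lambda>k. X (Suc k)) n) = trace (mat_prod (\<lambda>k. X (Suc k)) m ** X 0)"
    using assms by (simp add: Suc)
  also have "\<dots> = trace (mat_prod X n)"
    by (subst trace_mul_sym) (simp add: Suc mat_prod_Suc_shift del: mat_prod.simps(2))
  finally show ?thesis .
qed simp

lemma trace_mat_prod_root_of_unity:
  fixes a b c d z \<omega> :: "'a::field_char_0"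
  assumes "n > 0" and "\<omega> ^ n = 1" and prim: "\<And>k. 0 < k \<Longrightarrow> k < n \<Longrightarrow> \<omega> ^ k \<noteq> 1"
  shows "trace (mat_prod (\<lambda>k. mat2 a (b * (z * \<omega> ^ k)) c (d * (z * \<omega> ^ k))) n) =
    a ^ n + d ^ n * (\<Prod>k<n. z * \<omega> ^ k)"
proof -
  let ?F = "\<lambda>z. mat_prod (\<lambda>k. mat2 a (b * (z * \<omega> ^ k)) c (d * (z * \<omega> ^ k))) n"
  obtain p11 p12 p21 p22 where p:
    "\<And>z. ?F z = mat2 (poly p11 z) (poly p12 z) (poly p21 z) (poly p22 z)"
    "degree p11 \<le> n" "degree p22 \<le> n" "coeff p11 n = 0"
    "coeff p22 n = d ^ n * (\<Prod>k<n. \<omega> ^ k)" "coeff p11 0 = a ^ n" "coeff p22 0 = 0"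
    using mat_prod_poly[of a b \<omega> c d n] \<open>n > 0\<close> by blast
  define t where "t = p11 + p22"
  have tr: "trace (?F z) = poly t z" for z
    by (simp add: p(1) trace_mat2 t_def)
  \<comment> \<open>Replacing \<open>z\<close> by \<open>\<omega> * z\<close> shifts every index by
    one, and \<open>\<omega> ^ n = 1\<close> closes the cycle.\<close>
  have "poly t (\<omega> * z) = poly t z" for z
    using trace_mat_prod_rotate[of "\<lambda>k. mat2 a (b * (z * \<omega> ^ k)) c (d * (z * \<omega> ^ k))" n] assms(2)
    by (simp add: mult_ac flip: tr)
  then have "pcompose t [:0, \<omega>:] = t"
    by (intro poly_eq_poly_eq_iff[THEN iffD1] ext) (simp add: poly_pcompose mult.commute)
  then have "\<omega> ^ k * coeff t k = coeff t k" for k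
    using coeff_pcompose_linear[of t \<omega> k] by simp
  then have vanish: "coeff t k = 0" if "0 < k" "k < n" for k
    using prim[OF that] \<open>\<omega> ^ k * coeff t k = coeff t k\<close> by simp
  have "degree t \<le> n"
    unfolding t_def using p by (intro degree_add_le)
  then have "poly t z = (\<Sum>k\<le>n. coeff t k * z ^ k)"
    using arg_cong[OF poly_as_sum_of_monoms'[of t n], of "\<lambda>p. poly p z"]
    by (simp add: poly_sum poly_monom)
  also have "\<dots> = (\<Sum>k\<in>{0, n}. coeff t k * z ^ k)"
    by (rule sum.mono_neutral_right) (auto intro: vanish)
  \<comment> \<open>The constant term comes from \<open>p11\<close>, the top one from
    \<open>p22\<close>.\<close>
  also have "\<dots> = a ^ n + d ^ n * (\<Prod>k<n. z * \<omega> ^ k)"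
    using \<open>n > 0\<close> p by (simp add: t_def prod.distrib mult_ac)
  finally show ?thesis by (simp only: tr)
qed

section \<open>Lifting the product to SU(2)\<close>

definition su2 :: "complex \<Rightarrow> complex \<Rightarrow> complex ^ 2 ^ 2" where
  "su2 \<alpha> \<beta> = mat2 \<alpha> (- \<beta>) (cnj \<beta>) (cnj \<alpha>)"

lemma su2_mult:
  "su2 \<alpha> \<beta> ** su2 \<gamma> \<delta> = su2 (\<alpha> * \<gamma> - \<beta> * cnj \<delta>) (\<alpha> * \<delta> + \<beta> * cnj \<gamma>)"
  by (simp add: su2_def mat2_mult algebra_simps)

lemma trace_su2: "trace (su2 \<alpha> \<beta>) = of_real (2 * Re \<alpha>)"
  by (simp add: su2_def trace_mat2 complex_eq_iff)

text \<open>\<open>su2\<close> and \<open>quat_rot\<close> obey the same multiplication rule, so one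
  pair of complex numbers describes both products.\<close>

lemma mat_prod_su2_quat_rot:
  assumes "\<And>k. (cmod (\<gamma> k))\<^sup>2 + (cmod (\<delta> k))\<^sup>2 = 1"
  shows "\<exists>\<alpha> \<beta>. mat_prod (\<lambda>k. su2 (\<gamma> k) (\<delta> k)) n = su2 \<alpha> \<beta> \<and>
    mat_prod (\<lambda>k. quat_rot (\<gamma> k) (\<delta> k)) n = quat_rot \<alpha> \<beta> \<and> (cmod \<alpha>)\<^sup>2 + (cmod \<beta>)\<^sup>2 = 1"
proof (induction n)
  case 0
  show ?case
    by (rule exI[of _ 1], rule exI[of _ 0]) (simp add: su2_def mat2_one quat_rot_one)
next
  case (Suc n)
  then obtain \<alpha> \<beta> where IH: "mat_prod (\<lambda>k. su2 (\<gamma> k) (\<delta> k)) n = su2 \<alpha> \<beta>"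
    "mat_prod (\<lambda>k. quat_rot (\<gamma> k) (\<delta> k)) n = quat_rot \<alpha> \<beta>" "(cmod \<alpha>)\<^sup>2 + (cmod \<beta>)\<^sup>2 = 1"
    by blast
  \<comment> \<open>Multiplicativity of the quaternion norm.\<close>
  have "(cmod (\<alpha> * g - \<beta> * cnj d))\<^sup>2 + (cmod (\<alpha> * d + \<beta> * cnj g))\<^sup>2 =
    ((cmod \<alpha>)\<^sup>2 + (cmod \<beta>)\<^sup>2) * ((cmod g)\<^sup>2 + (cmod d)\<^sup>2)" for g d
    unfolding cmod_power2 by (simp add: power2_eq_square algebra_simps)
  then show ?case
    using IH assms
    by (intro exI[of _ "\<alpha> * \<gamma> n - \<beta> * cnj (\<delta> n)"] exI[of _ "\<alpha> * \<delta> n + \<beta> * cnj (\<gamma> n)"])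
       (simp add: su2_mult quat_rot_mult)
qed

lemma trace_mat_prod_su2:
  fixes c s :: real
  assumes root: "n > 0" "\<omega> ^ n = 1" "\<And>k. 0 < k \<Longrightarrow> k < n \<Longrightarrow> \<omega> ^ k \<noteq> 1"
    and norm: "\<And>k. cmod (u k) = 1"
    and step: "\<And>k. u k = z * \<omega> ^ k * u (Suc k)" and period: "u n = u 0"
  shows "trace (mat_prod (\<lambda>k. su2 (of_real c) (of_real s * u k)) n) = 2 * of_real (c ^ n)"
proof -
  have uu: "u k * cnj (u k) = 1" for k
    by (metis complex_norm_square norm of_real_1 power_one)
  \<comment> \<open>This is \<open>A diag(1, z \<omega>^k)\<close>, where \<open>A\<close> has rows
    \<open>(c, -s)\<close> and \<open>(s, c)\<close>.\<close>
  let ?B = "\<lambda>k. mat2 (of_real c) (- of_real s * (z * \<omega> ^ k)) (of_real s) (of_real c * (z * \<omega> ^ k))"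
  \<comment> \<open>Moving \<open>diag(1, u k)\<close> past one factor absorbs its phase and leaves
    \<open>diag(1, u (Suc k))\<close>, so the conjugations telescope.\<close>
  have gauge: "mat2 1 0 0 (u k) ** su2 (of_real c) (of_real s * u k) = ?B k ** mat2 1 0 0 (u (Suc k))" for k
  proof -
    have *: "u k * (of_real s * cnj (u k)) = of_real s"
      using uu[of k] by (metis mult.left_commute mult.right_neutral)
    have "mat2 1 0 0 (u k) ** su2 (of_real c) (of_real s * u k) =
      mat2 (of_real c) (- of_real s * u k) (of_real s) (of_real c * u k)"
      by (simp add: su2_def mat2_mult * mult.commute[of "u k" "of_real c"])
    also have "\<dots> = ?B k ** mat2 1 0 0 (u (Suc k))"
      by (simp add: mat2_mult step[of k] mult_ac)
    finally show ?thesis .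
  qed
  have "mat_prod (\<lambda>k. su2 (of_real c) (of_real s * u k)) m =
    mat2 1 0 0 (cnj (u 0)) ** mat_prod ?B m ** mat2 1 0 0 (u m)" for m
  proof (induction m)
    case 0
    show ?case using uu[of 0] by (simp add: mat2_mult mat2_one mult.commute)
  next
    case (Suc m)
    then show ?case
      by (simp add: gauge flip: matrix_mul_assoc)
  qed
  then have "trace (mat_prod (\<lambda>k. su2 (of_real c) (of_real s * u k)) n) =
    trace (mat2 1 0 0 (u 0) ** (mat2 1 0 0 (cnj (u 0)) ** mat_prod ?B n))"
    by (subst trace_mul_sym) (simp only: period)
  also have "\<dots> = trace (mat_prod ?B n)"
    using uu[of 0] by (simp add: matrix_mul_assoc mat2_mult mat2_one)
  also have "\<dots> = of_real c ^ n + of_real c ^ n * (\<Prod>k<n. z * \<omega> ^ k)"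
    by (rule trace_mat_prod_root_of_unity[OF root])
  \<comment> \<open>Going once around the cycle returns to \<open>u 0\<close>, so the accumulated
    phase is 1.\<close>
  also have "(\<Prod>k<n. z * \<omega> ^ k) = 1"
  proof -
    have "u 0 = (\<Prod>k<m. z * \<omega> ^ k) * u m" for m
    proof (induction m)
      case (Suc m)
      then show ?case using step[of m] by (simp add: mult_ac)
    qed simp
    from this[of n] have "1 * u 0 = (\<Prod>k<n. z * \<omega> ^ k) * u 0" by (simp only: period mult_1)
    moreover have "u 0 \<noteq> 0" using norm[of 0] by auto
    ultimately show ?thesis by (metis mult_right_cancel)
  qed
  finally show ?thesis by simp
qed

text \<open>The common pair \<open>\<alpha>\<close>, \<open>\<beta>\<close> links the two pictures:
  the trace is computed with \<open>su2\<close>, the angle is read off with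
  \<open>quat_rot\<close>.\<close>

lemma is_rotation_mat_prod_iff:
  assumes root: "n > 0" "\<omega> ^ n = 1" "\<And>k. 0 < k \<Longrightarrow> k < n \<Longrightarrow> \<omega> ^ k \<noteq> 1"
    and norm: "\<And>k. cmod (u k) = 1"
    and step: "\<And>k. u k = z * \<omega> ^ k * u (Suc k)" and period: "u n = u 0"
    and "cos (\<rho> / 2) \<ge> 0" "cos \<phi> \<ge> 0" "sin \<phi> > 0"
  shows "is_rotation_of_angle (mat_prod (\<lambda>k. rot (plane_vec (u k)) \<rho>) n) (2 * \<phi>) \<longleftrightarrow>
    cos (\<rho> / 2) ^ n = cos \<phi>"
proof -
  let ?c = "cos (\<rho> / 2)" and ?s = "sin (\<rho> / 2)"
  have "(cmod (of_real ?c))\<^sup>2 + (cmod (of_real ?s * u k))\<^sup>2 = 1" for k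
    by (simp add: norm_mult norm)
  from mat_prod_su2_quat_rot[where \<gamma> = "\<lambda>_. of_real ?c" and \<delta> = "\<lambda>k. of_real ?s * u k" and n = n, OF this] obtain \<alpha> \<beta> where
    ab: "mat_prod (\<lambda>k. su2 (of_real ?c) (of_real ?s * u k)) n = su2 \<alpha> \<beta>"
    "mat_prod (\<lambda>k. quat_rot (of_real ?c) (of_real ?s * u k)) n = quat_rot \<alpha> \<beta>"
    "(cmod \<alpha>)\<^sup>2 + (cmod \<beta>)\<^sup>2 = 1"
    by blast
  have "complex_of_real (2 * Re \<alpha>) = of_real (2 * ?c ^ n)"
    using trace_mat_prod_su2[OF assms(1-6), of ?c ?s] by (simp add: ab trace_su2)
  then have "Re \<alpha> = ?c ^ n"
    by (simp only: of_real_eq_iff)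
  then show ?thesis
    using is_rotation_quat_rot_iff[OF ab(3), of \<phi>] assms(7-9) by (simp add: rot_plane_vec norm ab(2))
qed

section \<open>Additive characters and quadratic Gauss sums\<close>

definition root_char :: "nat \<Rightarrow> int \<Rightarrow> complex" where
  "root_char q x = cis (2 * pi * of_int x / real q)"

lemma root_char_add: "root_char q (x + y) = root_char q x * root_char q y"
  by (simp add: root_char_def cis_mult distrib_left add_divide_distrib)

lemma root_char_power: "root_char q x ^ k = root_char q (int k * x)"
  unfolding root_char_def Complex.DeMoivre by (simp add: mult_ac)

lemma norm_root_char [simp]: "cmod (root_char q x) = 1"
  by (simp add: root_char_def)

lemma root_char_eq_1_iff:
  assumes "q > 0"
  shows "root_char q x = 1 \<longleftrightarrow> int q dvd x"
proof -
  have "root_char q x = 1 \<longleftrightarrow> (\<exists>k::int. of_int x = real q * of_int k)"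
    using assms by (simp add: root_char_def cis_conv_exp exp_eq_1 field_simps)
  also have "\<dots> \<longleftrightarrow> (\<exists>k::int. x = int q * k)"
    by (metis of_int_eq_iff of_int_mult of_int_of_nat_eq)
  finally show ?thesis by (simp add: dvd_def)
qed

lemma root_char_cong:
  assumes "int q dvd x - y"
  shows "root_char q x = root_char q y"
proof (cases "q = 0")
  case False
  then have "root_char q (x - y) = 1" using assms by (simp add: root_char_eq_1_iff)
  then show ?thesis using root_char_add[of q "x - y" y] by simp
qed (use assms in simp)

lemma gauss_sum_root_char: "gauss_sum a b q = (\<Sum>k<q. root_char q (a * int k ^ 2 + b * int k))"
  unfolding gauss_sum_def root_char_def cis_conv_exp
  by (intro sum.cong refl arg_cong[where f = exp]) (simp add: field_simps)

lemma gauss_sum_cong: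
  assumes "int q dvd n - m"
  shows "gauss_sum a n q = gauss_sum a m q"
  unfolding gauss_sum_root_char
proof (intro sum.cong refl root_char_cong)
  fix k
  have "a * (int k)\<^sup>2 + n * int k - (a * (int k)\<^sup>2 + m * int k) = (n - m) * int k"
    by (simp add: algebra_simps)
  then show "int q dvd a * (int k)\<^sup>2 + n * int k - (a * (int k)\<^sup>2 + m * int k)"
    using assms by simp
qed

text \<open>Spreads a one-step invariance over a residue class; it serves both for shifted sums and
  for the zero set of the Gauss sums.\<close>

lemma invariant_dvd:
  fixes f :: "int \<Rightarrow> 'a"
  assumes "\<And>n. f (n - d) = f n" and "d dvd m - n"
  shows "f m = f n"
proof -
  obtain k where k: "m = n + d * k"
    using assms(2) by (metis dvdE diff_add_cancel add.commute)
  have "f (n + d * k) = f n"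
  proof (induction k rule: int_induct[where k = 0])
    case (step1 i)
    then show ?case using assms(1)[of "n + d * (i + 1)"] by (simp add: algebra_simps)
  next
    case (step2 i)
    then show ?case using assms(1)[of "n + d * i"] by (simp add: algebra_simps)
  qed simp
  then show ?thesis by (simp add: k)
qed

text \<open>Consecutive shifts differ by a telescoping sum whose end terms agree by
  periodicity.\<close>

lemma sum_periodic_shift:
  fixes f :: "int \<Rightarrow> 'a::ab_group_add"
  assumes "\<And>x. f (x + int q) = f x"
  shows "(\<Sum>k<q. f (int k + a)) = (\<Sum>k<q. f (int k))"
proof -
  let ?S = "\<lambda>a. \<Sum>k<q. f (int k + a)"
  have "?S n - ?S (n - 1) = (\<Sum>k<q. f (int (Suc k) + (n - 1)) - f (int k + (n - 1)))" for n
    by (simp add: sum_subtractf algebra_simps)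
  also have "\<dots> n = f (int q + (n - 1)) - f (int 0 + (n - 1))" for n
    by (rule sum_lessThan_telescope)
  also have "\<dots> n = 0" for n
    using assms[of "n - 1"] by (simp add: add.commute)
  finally have "?S (n - 1) = ?S n" for n by simp
  from invariant_dvd[of ?S 1 a 0, OF this] show ?thesis by simp
qed

text \<open>Completing the square: the substitution \<open>k \<mapsto> k + a\<close> moves the linear coefficient by \<open>2pa\<close>.\<close>

lemma gauss_sum_shift:
  "gauss_sum (- p) n q = root_char q (n * a - p * a\<^sup>2) * gauss_sum (- p) (n - 2 * p * a) q"
proof -
  define f where "f x = root_char q (- p * x\<^sup>2 + n * x)" for x
  have "f (x + int q) = f x" for x
    unfolding f_def
  proof (rule root_char_cong)
    have "- p * (x + int q)\<^sup>2 + n * (x + int q) - (- p * x\<^sup>2 + n * x) =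
      int q * (n - p * (2 * x + int q))"
      by (simp add: algebra_simps power2_eq_square)
    then show "int q dvd - p * (x + int q)\<^sup>2 + n * (x + int q) - (- p * x\<^sup>2 + n * x)"
      by simp
  qed
  then have "gauss_sum (- p) n q = (\<Sum>k<q. f (int k + a))"
    using sum_periodic_shift[of f q a] by (simp add: gauss_sum_root_char f_def)
  also have "\<dots> = (\<Sum>k<q. root_char q (n * a - p * a\<^sup>2) *
      root_char q (- p * (int k)\<^sup>2 + (n - 2 * p * a) * int k))"
    unfolding f_def root_char_add[symmetric]
    by (intro sum.cong refl arg_cong[where f = "root_char q"])
       (simp add: algebra_simps power2_eq_square)
  finally show ?thesis
    by (simp add: gauss_sum_root_char sum_distrib_left)
qed

section \<open>Vanishing of the Gauss sums\<close>

lemma exists_gauss_sum_nonzero: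
  assumes "q > 0"
  shows "\<exists>n. gauss_sum a n q \<noteq> 0"
proof -
  \<comment> \<open>Orthogonality of characters: summing over all \<open>n\<close> leaves only
    \<open>k = 0\<close>, so the Gauss sums add up to \<open>q\<close> and cannot all
    vanish.\<close>
  have inner: "(\<Sum>n<q. root_char q (a * (int k)\<^sup>2 + int n * int k)) = (if k = 0 then of_nat q else 0)"
    if "k < q" for k
  proof (cases "k = 0")
    case True
    then show ?thesis by (simp add: root_char_def)
  next
    case False
    then have "root_char q (int k) \<noteq> 1"
      using that assms by (auto simp: root_char_eq_1_iff dest: nat_dvd_not_less)
    moreover have "root_char q (int k) ^ q = 1"
      using assms by (simp add: root_char_power root_char_eq_1_iff)
    ultimately have "(\<Sum>n<q. root_char q (int k) ^ n) = 0"
      by (simp add: geometric_sum)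
    then show ?thesis
      using False by (simp add: root_char_add root_char_power flip: sum_distrib_left)
  qed
  have "(\<Sum>n<q. gauss_sum a (int n) q) =
      (\<Sum>k<q. \<Sum>n<q. root_char q (a * (int k)\<^sup>2 + int n * int k))"
    unfolding gauss_sum_root_char by (rule sum.swap)
  also have "\<dots> = of_nat q"
    using assms by (simp add: inner)
  finally have "(\<Sum>n<q. gauss_sum a (int n) q) \<noteq> 0"
    using assms by simp
  then show ?thesis by (metis sum.not_neutral_contains_not_neutral)
qed

text \<open>The two sums differ by a phase, which is never zero.\<close>

lemma gauss_sum_step_zero_iff:
  assumes "int q dvd 2 * p * a - d"
  shows "gauss_sum (- p) (n - d) q = 0 \<longleftrightarrow> gauss_sum (- p) n q = 0"
proof -
  have "gauss_sum (- p) n q = root_char q (n * a - p * a\<^sup>2) * gauss_sum (- p) (n - d) q"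
    using gauss_sum_shift[of p n q a] gauss_sum_cong[of q "n - d" "n - 2 * p * a" "- p"] assms
    by simp
  moreover have "root_char q x \<noteq> 0" for x
    by (metis norm_root_char norm_zero zero_neq_one)
  ultimately show ?thesis by simp
qed

text \<open>With \<open>2 * p\<close> invertible the index can move in steps of 1, so one nonzero
  sum makes all of them nonzero.\<close>

lemma gauss_sum_nonzero_odd:
  assumes "q > 0" and "int q dvd 2 * p * a - 1"
  shows "gauss_sum (- p) n q \<noteq> 0"
proof -
  obtain m where "gauss_sum (- p) m q \<noteq> 0"
    using exists_gauss_sum_nonzero assms(1) by blast
  then show ?thesis
    using invariant_dvd[of "\<lambda>n. gauss_sum (- p) n q = 0" 1 m n] gauss_sum_step_zero_iff[OF assms(2)]
    by simp
qed

text \<open>Completing the square by half the period \<open>h\<close> fixes the index modulo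
  \<open>2 * h\<close> but produces the phase \<open>(-1)^(n - p * h)\<close>, which is -1
  here.\<close>

lemma gauss_sum_eq_0_even:
  assumes "h > 0" and "odd p" and "odd (n - int h)"
  shows "gauss_sum (- p) n (2 * h) = 0"
proof -
  have "root_char (2 * h) (n * int h - p * (int h)\<^sup>2) \<noteq> 1"
  proof
    assume "root_char (2 * h) (n * int h - p * (int h)\<^sup>2) = 1"
    then have "int h * 2 dvd int h * (n - p * int h)"
      using assms(1) by (simp add: root_char_eq_1_iff algebra_simps power2_eq_square)
    then have "even (n - p * int h)"
      using assms(1) by simp
    then show False using assms by auto
  qed
  moreover have "gauss_sum (- p) (n - 2 * p * int h) (2 * h) = gauss_sum (- p) n (2 * h)"
    by (rule gauss_sum_cong) simp
  ultimately show ?thesis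
    using gauss_sum_shift[of p n "2 * h" "int h"] by auto
qed

text \<open>The index of any nonzero sum must have the parity of \<open>h\<close>, and steps of 2
  reach every such index.\<close>

lemma gauss_sum_nonzero_even:
  assumes "h > 0" and "odd p" and "int (2 * h) dvd 2 * p * a - 2" and "even (n - int h)"
  shows "gauss_sum (- p) n (2 * h) \<noteq> 0"
proof -
  obtain m where m: "gauss_sum (- p) m (2 * h) \<noteq> 0"
    using exists_gauss_sum_nonzero assms(1) by force
  then have "even (m - int h)"
    using gauss_sum_eq_0_even assms by blast
  then have "2 dvd m - n" using assms(4) by presburger
  then show ?thesis
    using m invariant_dvd[of "\<lambda>n. gauss_sum (- p) n (2 * h) = 0" 2 m n]
      gauss_sum_step_zero_iff[OF assms(3)] by simp
qed

section \<open>Assembling the ordered product\<close>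

lemma exists_inverse_mod:
  fixes x q :: int
  assumes "coprime x q"
  obtains a where "q dvd x * a - 1" and "coprime a q"
proof -
  obtain a v where av: "a * x + v * q = 1"
    using bezout_int[of x q] assms by (auto simp: coprime_iff_gcd_eq_1)
  show thesis
  proof
    show "q dvd x * a - 1"
      using av by (intro dvdI[of _ _ "- v"]) (simp add: algebra_simps)
    \<comment> \<open>The same Bezout identity makes \<open>a\<close> invertible, which later gives
      the root of unity its exact order.\<close>
    show "coprime a q"
    proof (rule coprimeI)
      fix c assume "c dvd a" "c dvd q"
      then have "c dvd a * x + v * q" by simp
      then show "is_unit c" by (simp add: av)
    qed
  qed
qed

lemma upto_eq_map_int: "[0..int n - 1] = map int [0..<n]"
  by (induction n) (simp_all add: upto_rec2)

lemma filter_parity_upt: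
  fixes b :: int
  assumes "b = 0 \<or> b = 1"
  shows "filter (\<lambda>n. even (n - b)) (map int [0..<2 * h]) = map (\<lambda>j. b + 2 * int j) [0..<h]"
  using assms by (induction h) auto

text \<open>Meant for \<open>d = 1\<close> with \<open>q\<close> odd and \<open>d = 2\<close> with
  \<open>q\<close> even. Completing the square by \<open>a\<close> lowers the index by
  \<open>d\<close>, so consecutive phases differ by \<open>z \<omega>^j\<close> with
  \<open>z = root_char q (m * a - p * a\<^sup>2)\<close> and
  \<open>\<omega> = root_char q (- d * a)\<close>, of exact order \<open>N\<close>.\<close>

lemma is_rotation_gauss_prod_iff:
  assumes "q = d * N" and "q > 0" and "int q dvd 2 * p * a - int d" and "coprime a (int q)"
    and nonzero: "\<And>j. gauss_sum (- p) (m - int d * int j) q \<noteq> 0"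
    and "cos (\<rho> / 2) \<ge> 0" "cos \<phi> \<ge> 0" "sin \<phi> > 0"
  shows "is_rotation_of_angle
      (mat_prod (\<lambda>j. rot (plane_vec (cis (theta p q (m - int d * int j)))) \<rho>) N) (2 * \<phi>) \<longleftrightarrow>
    cos (\<rho> / 2) ^ N = cos \<phi>"
proof -
  define G where "G j = gauss_sum (- p) (m - int d * int j) q" for j
  have cis_theta: "cis (theta p q (m - int d * int j)) = sgn (G j)" for j
    using nonzero[of j] by (simp add: theta_def G_def cis_Arg)
  have "d > 0" "N > 0" using assms(1,2) by auto
  have sgn_root_char: "sgn (root_char q x) = root_char q x" for x
    by (simp add: sgn_div_norm)
  have step: "sgn (G j) = root_char q (m * a - p * a\<^sup>2) * root_char q (- int d * a) ^ j * sgn (G (Suc j))"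
    for j
  proof -
    have "G j = root_char q ((m - int d * int j) * a - p * a\<^sup>2) *
        gauss_sum (- p) (m - int d * int j - 2 * p * a) q"
      unfolding G_def by (rule gauss_sum_shift)
    also have "gauss_sum (- p) (m - int d * int j - 2 * p * a) q = G (Suc j)"
      unfolding G_def using assms(3)
      by (intro gauss_sum_cong) (simp add: algebra_simps dvd_diff_commute)
    also have "root_char q ((m - int d * int j) * a - p * a\<^sup>2) =
        root_char q (m * a - p * a\<^sup>2) * root_char q (- int d * a) ^ j"
      unfolding root_char_power root_char_add[symmetric]
      by (rule arg_cong[where f = "root_char q"]) (simp add: algebra_simps)
    finally show ?thesis by (simp add: sgn_mult sgn_root_char root_char_power)
  qed
  show ?thesis
    unfolding cis_theta
  proof (rule is_rotation_mat_prod_iff[OF \<open>N > 0\<close> _ _ _ step])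
    show "root_char q (- int d * a) ^ N = 1"
      using assms(1,2) by (simp add: root_char_power root_char_eq_1_iff)
    show "root_char q (- int d * a) ^ k \<noteq> 1" if "0 < k" "k < N" for k
    proof
      assume "root_char q (- int d * a) ^ k = 1"
      then have "int q dvd a * int (d * k)"
        using assms(2) by (simp add: root_char_power root_char_eq_1_iff mult_ac)
      \<comment> \<open>The unit \<open>a\<close> cancels modulo \<open>q\<close>.\<close>
      then have "d * N dvd d * k"
        using assms(1,4) by (simp add: coprime_dvd_mult_right_iff coprime_commute del: of_nat_mult)
      then show False
        using that \<open>d > 0\<close> by (auto dest: dvd_imp_le)
    qed
    show "cmod (sgn (G j)) = 1" for j
      using nonzero[of j] by (simp add: G_def norm_sgn)
    \<comment> \<open>The two indices differ by \<open>d * N = q\<close>.\<close>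
    have "G N = G 0"
      unfolding G_def using assms(1) by (intro gauss_sum_cong) simp
    then show "sgn (G N) = sgn (G 0)" by simp
  qed (use assms in auto)
qed

lemma rotation_product_eq_mat_prod:
  assumes "filter (\<lambda>n. \<not> 4 dvd int q - 2 * n) [0..int q - 1] = map (\<lambda>j. b + d * int j) [0..<N]"
  shows "rotation_product p q \<rho> =
    mat_prod (\<lambda>j. rot (plane_vec (cis (theta p q (int q - 1 - b - d * int j)))) \<rho>) N"
  unfolding rotation_product_def assms foldr_map
  by (subst foldr_eq_mat_prod[symmetric]) (simp add: comp_def algebra_simps)

theorem theorem2:
  fixes M q :: nat and p :: int and \<rho> :: real
  assumes "M \<ge> 3" and "q > 0" and "coprime p (int q)" and "0 \<le> \<rho>" and "\<rho> \<le> pi"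
  shows "is_rotation_of_angle (rotation_product p q \<rho>) (2 * pi / real M) \<longleftrightarrow>
    (if odd q then cos (\<rho> / 2) ^ q = cos (pi / real M)
     else cos (\<rho> / 2) ^ q = (cos (pi / real M))\<^sup>2)"
proof -
  have "pi / real M \<le> pi / 2" "pi / real M < pi" "0 < pi / real M"
    using assms(1) by (auto simp: field_simps)
  then have \<phi>: "cos (pi / real M) \<ge> 0" "sin (pi / real M) > 0"
    by (auto intro!: cos_ge_zero sin_gt_zero)
  have c: "cos (\<rho> / 2) \<ge> 0"
    using assms by (intro cos_ge_zero) auto
  show ?thesis
  proof (cases "odd q")
    case True
    \<comment> \<open>For odd \<open>q\<close> the inverse \<open>a\<close> of \<open>2 * p\<close>
      gives index steps of 1.\<close>
    then have "coprime (2 * p) (int q)" using assms(3) by simp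
    then obtain a where a: "int q dvd 2 * p * a - 1" "coprime a (int q)"
      using exists_inverse_mod by blast
    have "\<not> 4 dvd int q - 2 * n" for n
      using True by presburger
    then have "filter (\<lambda>n. \<not> 4 dvd int q - 2 * n) [0..int q - 1] =
        map (\<lambda>j. 0 + int 1 * int j) [0..<q]"
      by (simp add: upto_eq_map_int)
    then have "is_rotation_of_angle (rotation_product p q \<rho>) (2 * (pi / real M)) \<longleftrightarrow>
        cos (\<rho> / 2) ^ q = cos (pi / real M)"
      unfolding rotation_product_eq_mat_prod[OF \<open>filter _ _ = _\<close>]
      using a c \<phi> assms(2) gauss_sum_nonzero_odd[OF assms(2) a(1)]
      by (intro is_rotation_gauss_prod_iff[of q 1 q p a]) auto
    then show ?thesis using True by simp
  next
    case False
    then obtain h where h: "q = 2 * h" by blast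
    have "odd p" using assms(3) h by (auto simp: coprime_commute)
    obtain a where a: "int q dvd p * a - 1" "coprime a (int q)"
      using exists_inverse_mod assms(3) by blast
    \<comment> \<open>Only \<open>p\<close> is invertible now; doubling its inverse relation gives
      index steps of 2.\<close>
    have "int q dvd 2 * (p * a - 1)" using a(1) by (rule dvd_mult)
    then have a2: "int q dvd 2 * p * a - int 2" by (simp add: algebra_simps)
    \<comment> \<open>The smallest retained index: 4 fails to divide \<open>2 * h - 2 * n\<close>
      exactly when \<open>n\<close> and \<open>h\<close> have opposite parity.\<close>
    define b :: int where "b = (int h + 1) mod 2"
    have b01: "b = 0 \<or> b = 1" by (auto simp: b_def)
    have "(\<not> 4 dvd int q - 2 * n) \<longleftrightarrow> even (n - b)" for n
      unfolding h b_def by presburger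
    then have "filter (\<lambda>n. \<not> 4 dvd int q - 2 * n) [0..int q - 1] =
        map (\<lambda>j. b + int 2 * int j) [0..<h]"
      using filter_parity_upt[OF b01, of h] by (simp add: upto_eq_map_int h del: of_nat_mult)
    moreover have "gauss_sum (- p) (int q - 1 - b - int 2 * int j) q \<noteq> 0" for j
    proof -
      \<comment> \<open>Reflecting \<open>n\<close> to \<open>q - 1 - n\<close> flips the parity,
        landing on that of \<open>h\<close>, where the sums do not vanish.\<close>
      have "even (int (2 * h) - 1 - b - int 2 * int j - int h)"
        unfolding b_def of_nat_mult by presburger
      then show ?thesis
        using gauss_sum_nonzero_even[of h p a] assms(2) \<open>odd p\<close> a2 h by simp
    qed
    ultimately have "is_rotation_of_angle (rotation_product p q \<rho>) (2 * (pi / real M)) \<longleftrightarrow>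
        cos (\<rho> / 2) ^ h = cos (pi / real M)"
      unfolding rotation_product_eq_mat_prod[OF \<open>filter _ _ = _\<close>]
      using a a2 c \<phi> assms(2) h
      by (intro is_rotation_gauss_prod_iff[of q 2 h p a]) auto
    \<comment> \<open>Both sides are nonnegative, so squaring is reversible; it turns the exponent
      \<open>h\<close> into \<open>q\<close>.\<close>
    also have "\<dots> \<longleftrightarrow> (cos (\<rho> / 2) ^ h)\<^sup>2 = (cos (pi / real M))\<^sup>2"
      using c \<phi> by (simp add: power2_eq_iff_nonneg)
    also have "(cos (\<rho> / 2) ^ h)\<^sup>2 = cos (\<rho> / 2) ^ q"
      by (simp add: h mult.commute flip: power_mult)
    finally show ?thesis using False by simp
  qed
qed

end
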